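(* Let $\mathcal{M}=\langle S,S_0,T,A,H\rangle$ be the transition system of a consistent Boolean evolution system. Let $$X=\{s\in S\mid \forall s',\ (s,s')\in T\text{ implies }s'=s\}$$ be the set of states that only have self-loop transitions, and let $Y$ be the set of states of $S$ that can reach (in zero or more $T$-steps) some state in $X$. Then the system is stable if and only if $S_0\subseteq Y$.
   Context: A Boolean evolution system $BES=\langle\mathcal{B},\mathcal{R}\rangle$ consists of a finite set of variables $\mathcal{B}=\{b_1,\dots,b_n\}$, $n=n_1+n_2$, with $\mathcal{B}^{unknown}=\{b_1,\dots,b_{n_1}\}$ and $\mathcal{B}^{known}=\{b_{n_1+1},\dots,b_{n_1+n_2}\}$, and a finite set $\mathcal{R}$ of rules, each of the form $g\to b$ (assign $true$ to $b$) or $g\to\neg b$ (assign $false$ to $b$), where $g$ (the guard) is a Boolean formula over $\mathcal{B}$ and $b\in\mathcal{B}$. A valuation gives each known variable a value in $\{true,false\}$ and each unknown variable a value in $\{true,false,unknown\}$. Guards are evaluated to $true$, $false$ or $unknown$ (strong Kleene three-valued logic); a rule is enabled at a valuation if its guard evaluates to $true$. It is assumed that at each valuation the set of enabled rules is non-empty. The transition system $\mathcal{M}=\langle S,S_0,T,A,H\rangle$ of $BES$: $S$ is the set of all $3^{n_1}\cdot 2^{n_2}$ valuations; $S_0$ is the set of the $2^{n_2}$ valuations in which all unknown variables have value $unknown$; $(s,s')\in T$ iff $s'$ results from $s$ by simultaneously applying all enabled rules (synchronous semantics): for each variable $b$, $s'(b)=s(b)$ if no enabled rule assigns $b$; $s'(b)=true$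 (resp. $false$) if some enabled rule is of the form $g\to b$ (resp. $g\to\neg b$) and no enabled rule assigns the opposite value; and if enabled rules of both forms exist for $b$, then $s'(b)$ may be either $true$ or $false$ (so $k$ conflicting variables give $2^k$ successors). The atomic propositions $A$ and labelling $H$ play no role here. Consistency (in the relaxed sense): in no state reachable from $S_0$ are there two enabled rules that update the same variable with opposite values. Stability: a valuation is stable if no other valuation can be obtained from it (its only successor is itself); the system is stable if from any initial valuation (element of $S_0$), applying the rules recursively, it always eventually reaches a stable valuation (every infinite path from an initial state reaches a stable valuation). *)

theory Defs
  imports "HOL-Library.FuncSet"
begin

datatype tval = TrueV | FalseV | UnknownV

datatype 'v formula =
    Const bool
  | Var 'v
  | Neg "'v formula"
  | Conj "'v formula" "'v formula"
  | Disj "'v formula" "'v formula"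

text \<open>Strong Kleene connectives.\<close>

fun kleene_not :: "tval \<Rightarrow> tval" where
  "kleene_not TrueV = FalseV"
| "kleene_not FalseV = TrueV"
| "kleene_not UnknownV = UnknownV"

definition kleene_and :: "tval \<Rightarrow> tval \<Rightarrow> tval" where
  "kleene_and x y =
     (if x = FalseV \<or> y = FalseV then FalseV
      else if x = TrueV \<and> y = TrueV then TrueV
      else UnknownV)"

definition kleene_or :: "tval \<Rightarrow> tval \<Rightarrow> tval" where
  "kleene_or x y =
     (if x = TrueV \<or> y = TrueV then TrueV
      else if x = FalseV \<and> y = FalseV then FalseV
      else UnknownV)"

definition tval_of_bool :: "bool \<Rightarrow> tval" where
  "tval_of_bool c = (if c then TrueV else FalseV)"

primrec formula_value :: "('v \<Rightarrow> tval) \<Rightarrow> 'v formula \<Rightarrow> tval" where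
  "formula_value s (Const c) = tval_of_bool c"
| "formula_value s (Var b) = s b"
| "formula_value s (Neg f) = kleene_not (formula_value s f)"
| "formula_value s (Conj f g) = kleene_and (formula_value s f) (formula_value s g)"
| "formula_value s (Disj f g) = kleene_or (formula_value s f) (formula_value s g)"

text \<open>\<open>Rule g b True\<close> is the rule \<open>g \<rightarrow> b\<close>, and \<open>Rule g b False\<close> is \<open>g \<rightarrow> \<not>b\<close>.\<close>

datatype 'v rule = Rule (guard: "'v formula") (target: 'v) (assigned: bool)

record 'v bes =
  unknown_vars :: "'v set"
  known_vars :: "'v set"
  rules :: "'v rule set"

definition vars :: "'v bes \<Rightarrow> 'v set" where
  "vars E = unknown_vars E \<union> known_vars E"

text \<open>Valuations are \<open>undefined\<close> outside the variables of the system, so that equality of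
  valuations is agreement on these variables.\<close>

definition states :: "'v bes \<Rightarrow> ('v \<Rightarrow> tval) set" where
  "states E = (\<Pi>\<^sub>E b\<in>vars E. if b \<in> unknown_vars E then {TrueV, FalseV, UnknownV}
                              else {TrueV, FalseV})"

definition initial_states :: "'v bes \<Rightarrow> ('v \<Rightarrow> tval) set" where
  "initial_states E = (\<Pi>\<^sub>E b\<in>vars E. if b \<in> unknown_vars E then {UnknownV}
                                      else {TrueV, FalseV})"

definition enabled :: "'v bes \<Rightarrow> ('v \<Rightarrow> tval) \<Rightarrow> 'v rule set" where
  "enabled E s = {r \<in> rules E. formula_value s (guard r) = TrueV}"

definition boolean_evolution_system :: "'v bes \<Rightarrow> bool" where
  "boolean_evolution_system E \<longleftrightarrow>
     finite (unknown_vars E) \<and> finite (known_vars E) \<and>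
     unknown_vars E \<inter> known_vars E = {} \<and>
     finite (rules E) \<and>
     (\<forall>r\<in>rules E. set_formula (guard r) \<subseteq> vars E \<and> target r \<in> vars E) \<and>
     (\<forall>s\<in>states E. enabled E s \<noteq> {})"

definition assigns :: "'v bes \<Rightarrow> ('v \<Rightarrow> tval) \<Rightarrow> 'v \<Rightarrow> bool \<Rightarrow> bool" where
  "assigns E s b c \<longleftrightarrow> (\<exists>r\<in>enabled E s. target r = b \<and> assigned r = c)"

definition next_values :: "'v bes \<Rightarrow> ('v \<Rightarrow> tval) \<Rightarrow> 'v \<Rightarrow> tval set" where
  "next_values E s b =
     (if assigns E s b True \<and> assigns E s b False then {TrueV, FalseV}
      else if assigns E s b True then {TrueV}
      else if assigns E s b False then {FalseV}
      else {s b})"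

definition transitions :: "'v bes \<Rightarrow> (('v \<Rightarrow> tval) \<times> ('v \<Rightarrow> tval)) set" where
  "transitions E = {(s, s'). s \<in> states E \<and> s' \<in> (\<Pi>\<^sub>E b\<in>vars E. next_values E s b)}"

text \<open>Consistency in the relaxed sense: only states reachable from an initial state matter.\<close>

definition consistent :: "'v bes \<Rightarrow> bool" where
  "consistent E \<longleftrightarrow>
     (\<forall>s\<^sub>0\<in>initial_states E. \<forall>s. (s\<^sub>0, s) \<in> (transitions E)\<^sup>* \<longrightarrow>
        \<not> (\<exists>r\<in>enabled E s. \<exists>r'\<in>enabled E s.
             target r = target r' \<and> assigned r \<noteq> assigned r'))"

definition stable_valuation :: "'v bes \<Rightarrow> ('v \<Rightarrow> tval) \<Rightarrow> bool" where
  "stable_valuation E s \<longleftrightarrow> transitions E `` {s} = {s}"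

definition stable_system :: "'v bes \<Rightarrow> bool" where
  "stable_system E \<longleftrightarrow>
     (\<forall>p :: nat \<Rightarrow> 'v \<Rightarrow> tval.
        p 0 \<in> initial_states E \<and> (\<forall>i. (p i, p (Suc i)) \<in> transitions E) \<longrightarrow>
        (\<exists>i. stable_valuation E (p i)))"

lemma card_states:
  assumes "boolean_evolution_system E"
  shows "card (states E) = 3 ^ card (unknown_vars E) * 2 ^ card (known_vars E)"
proof -
  have fin: "finite (unknown_vars E)" "finite (known_vars E)"
    and dj: "unknown_vars E \<inter> known_vars E = {}"
    using assms by (auto simp: boolean_evolution_system_def)
  have "card (states E) = (\<Prod>b\<in>vars E. if b \<in> unknown_vars E then 3 else 2)"
    using fin unfolding states_def
    by (subst card_PiE) (auto simp: vars_def intro!: prod.cong)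
  also have "\<dots> = (\<Prod>b\<in>unknown_vars E. if b \<in> unknown_vars E then 3 else 2)
      * (\<Prod>b\<in>known_vars E. if b \<in> unknown_vars E then 3 else 2)"
    unfolding vars_def using fin dj by (rule prod.union_disjoint)
  also have "(\<Prod>b\<in>known_vars E. if b \<in> unknown_vars E then 3 else 2)
      = (\<Prod>b\<in>known_vars E. 2::nat)"
    using dj by (intro prod.cong) auto
  finally show ?thesis by simp
qed

lemma card_initial_states:
  assumes "boolean_evolution_system E"
  shows "card (initial_states E) = 2 ^ card (known_vars E)"
proof -
  have fin: "finite (unknown_vars E)" "finite (known_vars E)"
    and dj: "unknown_vars E \<inter> known_vars E = {}"
    using assms by (auto simp: boolean_evolution_system_def)
  have "card (initial_states E) = (\<Prod>b\<in>vars E. if b \<in> unknown_vars E then 1 else 2)"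
    using fin unfolding initial_states_def
    by (subst card_PiE) (auto simp: vars_def intro!: prod.cong)
  also have "\<dots> = (\<Prod>b\<in>unknown_vars E. if b \<in> unknown_vars E then 1 else 2)
      * (\<Prod>b\<in>known_vars E. if b \<in> unknown_vars E then 1 else 2)"
    unfolding vars_def using fin dj by (rule prod.union_disjoint)
  also have "(\<Prod>b\<in>known_vars E. if b \<in> unknown_vars E then 1 else 2)
      = (\<Prod>b\<in>known_vars E. 2::nat)"
    using dj by (intro prod.cong) auto
  finally show ?thesis by simp
qed

lemma initial_states_subset: "initial_states E \<subseteq> states E"
  unfolding initial_states_def states_def by (rule PiE_mono) auto

lemma transitions_subset: "transitions E \<subseteq> states E \<times> states E"
proof -
  have "s' \<in> states E" if "(s, s') \<in> transitions E" for s s'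
  proof -
    have s: "s \<in> states E" and s': "s' \<in> (\<Pi>\<^sub>E b\<in>vars E. next_values E s b)"
      using that by (auto simp: transitions_def)
    have "next_values E s b \<subseteq>
        (if b \<in> unknown_vars E then {TrueV, FalseV, UnknownV} else {TrueV, FalseV})"
      if "b \<in> vars E" for b
      using PiE_mem[OF s[unfolded states_def] that] by (auto simp: next_values_def split: if_splits)
    then show ?thesis
      using s' PiE_mono[of "vars E" "next_values E s"] unfolding states_def by blast
  qed
  then show ?thesis by (auto simp: transitions_def)
qed

end

theory Submission
  imports Defs
begin

text \<open>Every state has a successor, so a state is stable iff it has no successor but itself, and
  every initial state starts an infinite path. By consistency each reachable state has exactly one
  successor, so the only infinite path from an initial state visits all states reachable from it.\<close>

lemma next_values_nonempty: "next_values E s b \<noteq> {}"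
  by (simp add: next_values_def)

text \<open>A variable that no enabled rule assigns keeps its value and a conflicting one has two
  options, so no factor of the product is empty.\<close>

lemma successor_exists:
  assumes "s \<in> states E"
  obtains s' where "(s, s') \<in> transitions E"
proof -
  have "(\<Pi>\<^sub>E b\<in>vars E. next_values E s b) \<noteq> {}"
    by (simp add: PiE_eq_empty_iff next_values_nonempty)
  with assms that show thesis
    by (auto simp: transitions_def)
qed

text \<open>A state without successors would satisfy the right-hand side vacuously, but its image
  would be empty instead of \<open>{s}\<close>; the existence of a successor excludes this
  case.\<close>

lemma stable_valuation_iff:
  assumes "s \<in> states E"
  shows "stable_valuation E s \<longleftrightarrow> (\<forall>s'. (s, s') \<in> transitions E \<longrightarrow> s' = s)"
proof -
  obtain s' where "(s, s') \<in> transitions E"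
    using assms by (rule successor_exists)
  then show ?thesis
    unfolding stable_valuation_def by blast
qed

text \<open>Stability speaks of infinite paths only, so it yields information about an initial state
  only through such a path.\<close>

lemma infinite_path_exists:
  assumes "s \<in> states E"
  obtains p :: "nat \<Rightarrow> 'v \<Rightarrow> tval"
    where "p 0 = s" "\<And>i. (p i, p (Suc i)) \<in> transitions E"
proof -
  have "\<exists>p. p 0 = s \<and> (\<forall>i. p i \<in> states E \<and> (p i, p (Suc i)) \<in> transitions E)"
  \<comment> \<open>The conjunct \<open>i = 0 \<longrightarrow> t = s\<close> pins the start of the
    path; membership in \<open>states E\<close> keeps it extendable.\<close>
  proof (rule dependent_nat_choice[where P = "\<lambda>i t. (i = 0 \<longrightarrow> t = s) \<and> t \<in> states E"
        and Q = "\<lambda>_ t t'. (t, t') \<in> transitions E", THEN exE])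
    show "\<exists>t. (0 = (0::nat) \<longrightarrow> t = s) \<and> t \<in> states E"
      using assms by blast
  next
    fix t and i :: nat
    assume "(i = 0 \<longrightarrow> t = s) \<and> t \<in> states E"
    then obtain t' where "(t, t') \<in> transitions E"
      using successor_exists by blast
    then show "\<exists>t'. ((Suc i = 0 \<longrightarrow> t' = s) \<and> t' \<in> states E) \<and> (t, t') \<in> transitions E"
      using transitions_subset by blast
  qed blast
  with that show thesis by blast
qed

lemma path_reachable:
  assumes "\<And>i. (p i, p (Suc i)) \<in> r"
  shows "(p 0, p n) \<in> r\<^sup>*"
  using assms by (induction n) (auto intro: rtrancl_into_rtrancl)

text \<open>Determinism is asked only at states reachable from \<open>p 0\<close>, which is all that
  relaxed consistency provides; each \<open>p n\<close> is such a state.\<close>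

lemma path_eq_if_deterministic:
  assumes path: "\<And>i. (p i, p (Suc i)) \<in> r"
    and det: "\<And>s t t'. (p 0, s) \<in> r\<^sup>* \<Longrightarrow> (s, t) \<in> r \<Longrightarrow> (s, t') \<in> r \<Longrightarrow> t = t'"
  shows "(p 0, x) \<in> r ^^ n \<Longrightarrow> p n = x"
proof (induction n arbitrary: x)
  case (Suc n)
  then obtain y where "(p 0, y) \<in> r ^^ n" "(y, x) \<in> r"
    by auto
  with Suc.IH have "(p n, x) \<in> r"
    by blast
  with path path_reachable[of p r n] det show ?case
    by blast
qed simp

text \<open>Only a conflict offers two next values. Without one, every factor of the product is a
  singleton.\<close>

lemma consistent_deterministic:
  assumes "consistent E" "s\<^sub>0 \<in> initial_states E" "(s\<^sub>0, s) \<in> (transitions E)\<^sup>*"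
    and "(s, t) \<in> transitions E" "(s, t') \<in> transitions E"
  shows "t = t'"
proof (rule PiE_ext)
  show "t \<in> (\<Pi>\<^sub>E b\<in>vars E. next_values E s b)" "t' \<in> (\<Pi>\<^sub>E b\<in>vars E. next_values E s b)"
    using assms(4,5) by (auto simp: transitions_def)
  then have mem: "t b \<in> next_values E s b" "t' b \<in> next_values E s b" if "b \<in> vars E" for b
    using that by auto
  have "\<not> (assigns E s b True \<and> assigns E s b False)" for b
    using assms(1-3) unfolding consistent_def assigns_def by metis
  then show "t b = t' b" if "b \<in> vars E" for b
    using mem[OF that] by (auto simp: next_values_def split: if_splits)
qed

theorem theorem3:
  fixes E :: "'v bes"
    and X Y :: "('v \<Rightarrow> tval) set"
  assumes "boolean_evolution_system E"
    and "consistent E"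
    and X: "X = {s \<in> states E. \<forall>s'. (s, s') \<in> transitions E \<longrightarrow> s' = s}"
    and Y: "Y = {s \<in> states E. \<exists>x\<in>X. (s, x) \<in> (transitions E)\<^sup>*}"
  shows "stable_system E \<longleftrightarrow> initial_states E \<subseteq> Y"
proof
  assume stable: "stable_system E"
  show "initial_states E \<subseteq> Y"
  proof
    fix s assume init: "s \<in> initial_states E"
    then have s: "s \<in> states E"
      using initial_states_subset by blast
    then obtain p where p: "p 0 = s" "\<And>i. (p i, p (Suc i)) \<in> transitions E"
      by (rule infinite_path_exists) blast
    with stable init obtain i where "stable_valuation E (p i)"
      unfolding stable_system_def by blast
    moreover have "p i \<in> states E"
      using p(2)[of i] transitions_subset by blast
    ultimately have "p i \<in> X"
      by (simp add: X stable_valuation_iff)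
    with s path_reachable[of p, OF p(2), of i] p(1) show "s \<in> Y"
      by (auto simp: Y)
  qed
next
  assume sub: "initial_states E \<subseteq> Y"
  show "stable_system E"
    unfolding stable_system_def
  proof (intro allI impI, elim conjE)
    fix p :: "nat \<Rightarrow> 'v \<Rightarrow> tval"
    assume init: "p 0 \<in> initial_states E" and path: "\<forall>i. (p i, p (Suc i)) \<in> transitions E"
    obtain x where x: "x \<in> X" "(p 0, x) \<in> (transitions E)\<^sup>*"
      using sub init Y by blast
    \<comment> \<open>Membership in \<open>Y\<close> gives just some run to \<open>x\<close>; its
      length \<open>n\<close> is the index at which the given path must meet
      \<open>x\<close>.\<close>
    then obtain n where "(p 0, x) \<in> transitions E ^^ n"
      by (auto simp: rtrancl_power)
    then have "p n = x"
      using path consistent_deterministic[OF assms(2) init]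
      by (intro path_eq_if_deterministic[of p "transitions E"]) blast+
    with x(1) have "stable_valuation E (p n)"
      by (simp add: X stable_valuation_iff)
    then show "\<exists>i. stable_valuation E (p i)" ..
  qed
qed

end
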